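(* Let $H$ be a connected graph with $n(H)\ge 2$. Then (i) $\underline{{\rm gp}}_{\rm S}(K_2,H)=2\xi^{-}(H)$, and (ii) ${\rm gp}_{\rm S}(K_2,H)=2\xi(H)$.
   Context: All graphs are finite, simple and connected; $n(H)=|V(H)|$. For vertices $x,y$, $I_H[x,y]=\{w: d_H(x,y)=d_H(x,w)+d_H(w,y)\}$ with $d_H$ the distance. A set $X$ of vertices is a general position set if no shortest path contains more than two vertices of $X$; ${\rm gp}$ denotes the maximum cardinality of a general position set. For $u\in V(H)$, a set $S\subseteq V(H)$ is $u$-colinear if $S$ is a general position set of $H$, $u\notin S$, and $y\notin I_H[x,u]$ for all distinct $x,y\in S$; $\xi_H(u)$ is the maximum cardinality of a $u$-colinear set, $\xi^{-}(H)=\min_{u}\xi_H(u)$ and $\xi(H)=\max_u\xi_H(u)$. For $f\colon V(G)\to V(H)$, the Sierpiński product $G\otimes_f H$ has vertex set $V(G)\times V(H)$ and edges $(g,h)(g,h')$ for $g\in V(G)$, $hh'\in E(H)$, and $(g,f(g'))(g',f(g))$ for $gg'\in E(G)$. ${\rm gp}_{\rm S}(G,H)=\max_f{\rm gp}(G\otimes_f H)$ and $\underline{{\rm gp}}_{\rm S}(G,H)=\min_f{\rm gp}(G\otimes_f H)$, over all functions $f\colon V(G)\to V(H)$. *)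

theory Defs
  imports "Graph_Theory.Graph_Theory" "HOL-Library.FuncSet"
begin

text \<open>
  A finite simple graph is a \<open>pair_graph\<close>: each edge \<open>xy\<close> is represented by the two
  arcs \<open>(x, y)\<close> and \<open>(y, x)\<close>.
\<close>

text \<open>
  The value is meaningful only if \<open>y\<close> is reachable from \<open>x\<close>; see \<open>gdist_eq_\<mu>\<close> below
  for the agreement with the weighted distance \<open>\<mu>\<close> under unit weights.
\<close>

definition gdist :: "'a pair_pre_digraph \<Rightarrow> 'a \<Rightarrow> 'a \<Rightarrow> nat" where
  "gdist H x y = (LEAST n. \<exists>p. pre_digraph.awalk (with_proj H) x p y \<and> length p = n)"

definition ginterval :: "'a pair_pre_digraph \<Rightarrow> 'a \<Rightarrow> 'a \<Rightarrow> 'a set" where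
  "ginterval H x y = {w \<in> pverts H. gdist H x y = gdist H x w + gdist H w y}"

definition shortest_path :: "'a pair_pre_digraph \<Rightarrow> 'a \<Rightarrow> ('a \<times> 'a) awalk \<Rightarrow> 'a \<Rightarrow> bool" where
  "shortest_path H x p y \<longleftrightarrow> pre_digraph.apath (with_proj H) x p y \<and> length p = gdist H x y"

definition general_position :: "'a pair_pre_digraph \<Rightarrow> 'a set \<Rightarrow> bool" where
  "general_position H X \<longleftrightarrow> X \<subseteq> pverts H \<and>
    (\<forall>x p y. shortest_path H x p y \<longrightarrow>
      card (X \<inter> set (pre_digraph.awalk_verts (with_proj H) x p)) \<le> 2)"

definition gp :: "'a pair_pre_digraph \<Rightarrow> nat" where
  "gp H = Max {card X | X. general_position H X}"

definition colinear :: "'a pair_pre_digraph \<Rightarrow> 'a \<Rightarrow> 'a set \<Rightarrow> bool" where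
  "colinear H u S \<longleftrightarrow> general_position H S \<and> u \<notin> S \<and>
    (\<forall>x\<in>S. \<forall>y\<in>S. x \<noteq> y \<longrightarrow> y \<notin> ginterval H x u)"

definition \<xi>_at :: "'a pair_pre_digraph \<Rightarrow> 'a \<Rightarrow> nat" where
  "\<xi>_at H u = Max {card S | S. colinear H u S}"

definition \<xi>_min :: "'a pair_pre_digraph \<Rightarrow> nat" where
  "\<xi>_min H = Min (\<xi>_at H ` pverts H)"

definition \<xi>_max :: "'a pair_pre_digraph \<Rightarrow> nat" where
  "\<xi>_max H = Max (\<xi>_at H ` pverts H)"

definition sierpinski_product ::
  "'a pair_pre_digraph \<Rightarrow> ('a \<Rightarrow> 'b) \<Rightarrow> 'b pair_pre_digraph \<Rightarrow> ('a \<times> 'b) pair_pre_digraph" where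
  "sierpinski_product G f H = \<lparr>
     pverts = pverts G \<times> pverts H,
     parcs = {((g, h), (g, h')) | g h h'. g \<in> pverts G \<and> (h, h') \<in> parcs H}
           \<union> {((g, f g'), (g', f g)) | g g'. (g, g') \<in> parcs G} \<rparr>"

definition gp_S_max :: "'a pair_pre_digraph \<Rightarrow> 'b pair_pre_digraph \<Rightarrow> nat" where
  "gp_S_max G H = Max {gp (sierpinski_product G f H) | f. f \<in> pverts G \<rightarrow>\<^sub>E pverts H}"

definition gp_S_min :: "'a pair_pre_digraph \<Rightarrow> 'b pair_pre_digraph \<Rightarrow> nat" where
  "gp_S_min G H = Min {gp (sierpinski_product G f H) | f. f \<in> pverts G \<rightarrow>\<^sub>E pverts H}"

lemma gdist_eq_\<mu>:
  assumes "pair_wf_digraph H" and "x \<rightarrow>\<^sup>*\<^bsub>with_proj H\<^esub> y"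
  shows "ereal (real (gdist H x y)) = wf_digraph.\<mu> (with_proj H) (\<lambda>_. 1) x y"
proof -
  interpret pair_wf_digraph H by fact
  have cost: "awalk_cost (\<lambda>_. 1) p = real (length p)" for p :: "('a \<times> 'a) awalk"
    by (induct p) auto
  from assms(2) obtain q where "awalk x q y" by (auto simp: reachable_awalk)
  then have "\<exists>n p. awalk x p y \<and> length p = n" by blast
  then have "\<exists>p. awalk x p y \<and> length p = gdist H x y"
    unfolding gdist_def by (rule LeastI_ex)
  then obtain p where p: "awalk x p y" "length p = gdist H x y" by blast
  have le: "gdist H x y \<le> length q" if "awalk x q y" for q
    unfolding gdist_def using that by (blast intro: Least_le)
  show ?thesis
    unfolding \<mu>_def cost
  proof (rule INF_eqI[symmetric])
    show "ereal (real (gdist H x y)) \<le> ereal (real (length q))" if "q \<in> {p. awalk x p y}" for q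
      using that le by simp
    show "l \<le> ereal (real (gdist H x y))"
      if "\<And>q. q \<in> {p. awalk x p y} \<Longrightarrow> l \<le> ereal (real (length q))" for l
      using that[of p] p(1) unfolding p(2) by simp
  qed
qed

lemma pair_graph_sierpinski_product:
  assumes G: "pair_graph G" and H: "pair_graph H"
    and f: "f \<in> pverts G \<rightarrow> pverts H"
  shows "pair_graph (sierpinski_product G f H)" (is "pair_graph ?P")
proof -
  interpret G: pair_graph G by fact
  interpret H: pair_graph H by fact
  have sub: "parcs ?P \<subseteq> pverts ?P \<times> pverts ?P"
    using f by (auto simp: sierpinski_product_def dest: G.in_arcsD1 G.in_arcsD2
        H.in_arcsD1 H.in_arcsD2)
  have fin: "finite (pverts ?P)"
    by (simp add: sierpinski_product_def G.pair_finite_verts H.pair_finite_verts)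
  have symm: "symmetric (with_proj ?P)"
    unfolding symmetric_def with_proj_simps
  proof (rule symI)
    fix a b assume "(a, b) \<in> parcs ?P"
    then show "(b, a) \<in> parcs ?P"
      using G.arcs_symmetric H.arcs_symmetric unfolding sierpinski_product_def by auto
  qed
  have loopfree: "fst e \<noteq> snd e" if "e \<in> parcs ?P" for e
    using that G.pair_no_loops H.pair_no_loops unfolding sierpinski_product_def by force
  show ?thesis
  proof
    show "finite (parcs ?P)"
      by (rule finite_subset[OF sub finite_cartesian_product[OF fin fin]])
    show "fst e \<in> pverts ?P" "snd e \<in> pverts ?P" if "e \<in> parcs ?P" for e
      using subsetD[OF sub that] by (simp_all add: mem_Times_iff)
  qed (fact loopfree fin symm)+
qed

end

theory Submission
  imports Defs
begin

text \<open>
  The product of \<open>K\<^sub>2\<close> with \<open>H\<close> is two copies of \<open>H\<close> joined by a bridge, so intervals of the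
  product are intervals of \<open>H\<close> within a copy, and pass through the ends of the bridge otherwise.
  For fixed \<open>u\<close> the relation \<open>y \<in> I[x, u]\<close> is a partial order on the vertices, and a \<open>u\<close>-colinear
  set is a general position set that is an antichain of this order and avoids \<open>u\<close>. A general
  position set meeting both copies consists of an antichain in each of them, with respect to the
  end of the bridge; conversely any two colinear sets combine. A general position set inside one
  copy is no larger: it contains no chain of three elements, whence it is a union of two
  antichains. Hence \<open>gp\<close> of the product is the sum of \<open>\<xi>_at H (f g)\<close> over the two vertices \<open>g\<close> of
  \<open>K\<^sub>2\<close>, and the two values of \<open>f\<close> range independently over the vertices of \<open>H\<close>.
\<close>

section \<open>Distances\<close>

context pair_wf_digraph
begin

lemma gdist_le_length:
  assumes "awalk x p y"
  shows "gdist G x y \<le> length p"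
  unfolding gdist_def using assms by (blast intro: Least_le)

lemma gdist_awalkE:
  assumes "x \<rightarrow>\<^sup>*\<^bsub>G\<^esub> y"
  obtains p where "awalk x p y" "length p = gdist G x y"
proof -
  have "\<exists>n p. awalk x p y \<and> length p = n" using assms by (auto simp: reachable_awalk)
  then have "\<exists>p. awalk x p y \<and> length p = gdist G x y"
    unfolding gdist_def by (rule LeastI_ex)
  then show thesis using that by blast
qed

lemma gdist_self [simp]:
  assumes "x \<in> pverts G"
  shows "gdist G x x = 0"
  using gdist_le_length[of x "[]" x] assms by (simp add: awalk_Nil_iff)

lemma gdist_eq_0_iff:
  assumes "x \<rightarrow>\<^sup>*\<^bsub>G\<^esub> y"
  shows "gdist G x y = 0 \<longleftrightarrow> x = y"
proof
  assume "gdist G x y = 0"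
  then show "x = y" by (auto intro: gdist_awalkE[OF assms] simp: awalk_Nil_iff)
next
  assume "x = y"
  then show "gdist G x y = 0" using reachable_in_verts(1)[OF assms] by simp
qed

lemma gdist_triangle:
  assumes "x \<rightarrow>\<^sup>*\<^bsub>G\<^esub> y" "y \<rightarrow>\<^sup>*\<^bsub>G\<^esub> z"
  shows "gdist G x z \<le> gdist G x y + gdist G y z"
proof -
  obtain p where p: "awalk x p y" "length p = gdist G x y" using assms(1) by (rule gdist_awalkE)
  obtain q where q: "awalk y q z" "length q = gdist G y z" using assms(2) by (rule gdist_awalkE)
  show ?thesis using gdist_le_length[OF awalk_appendI[OF p(1) q(1)]] p(2) q(2) by simp
qed

lemma gdist_arc_le_Suc:
  assumes "(x, y) \<in> parcs G" "y \<rightarrow>\<^sup>*\<^bsub>G\<^esub> z"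
  shows "gdist G x z \<le> Suc (gdist G y z)"
proof -
  obtain p where p: "awalk y p z" "length p = gdist G y z" using assms(2) by (rule gdist_awalkE)
  have walk: "awalk x ((x, y) # p) z" using assms(1) p(1) by (simp add: awalk_Cons_iff)
  show ?thesis using gdist_le_length[OF walk] p(2) by simp
qed

lemma potential_le_add_gdist:
  fixes \<phi> :: "'a \<Rightarrow> nat"
  assumes "x \<rightarrow>\<^sup>*\<^bsub>G\<^esub> y" and arcs: "\<And>u v. (u, v) \<in> parcs G \<Longrightarrow> \<phi> u \<le> Suc (\<phi> v)"
  shows "\<phi> x \<le> \<phi> y + gdist G x y"
proof -
  have "\<phi> x \<le> \<phi> y + length p" if "awalk x p y" for x p
    using that
  proof (induction p arbitrary: x)
    case Nil
    then show ?case by (simp add: awalk_Nil_iff)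
  next
    case (Cons e p)
    then have "\<phi> (snd e) \<le> \<phi> y + length p" "(x, snd e) \<in> parcs G"
      by (auto simp: awalk_Cons_iff)
    then show ?case using arcs[of x "snd e"] by simp
  qed
  moreover obtain p where "awalk x p y" "length p = gdist G x y"
    using assms(1) by (rule gdist_awalkE)
  ultimately show ?thesis by metis
qed

lemma shortest_path_iff_awalk:
  "shortest_path G x p y \<longleftrightarrow> awalk x p y \<and> length p = gdist G x y"
proof
  assume p: "awalk x p y \<and> length p = gdist G x y"
  have "distinct (pawalk_verts x p)"
  proof (rule ccontr)
    assume "\<not> distinct (pawalk_verts x p)"
    then obtain q r s w where pqrs: "p = q @ r @ s" "0 < length r" "awalk x q w" "awalk w s y"
      using awalk_not_distinct_decomp[of x p y] p by blast
    have "gdist G x y \<le> length (q @ s)" using pqrs by (intro gdist_le_length awalk_appendI)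
    also have "\<dots> < length p" using pqrs by simp
    finally show False using p by simp
  qed
  then show "shortest_path G x p y" using p by (simp add: shortest_path_def apath_def)
qed (simp add: shortest_path_def apath_def)

lemma awalk_take_drop_nth:
  assumes "awalk x p y" "i \<le> length p"
  shows "awalk x (take i p) (pawalk_verts x p ! i)" "awalk (pawalk_verts x p ! i) (drop i p) y"
proof -
  have cas: "pcas x p y" using assms(1) by auto
  have "last (pawalk_verts x (take i p)) = pawalk_verts x p ! i"
    using assms awalk_verts_take_conv[OF cas, of i] length_awalk_verts[of x p]
    by (simp add: take_Suc_conv_app_nth)
  then show "awalk x (take i p) (pawalk_verts x p ! i)" "awalk (pawalk_verts x p ! i) (drop i p) y"
    using assms(1) awalk_append_iff[of x "take i p" "drop i p" y] by auto
qed

lemma gdist_shortest_path_nth: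
  assumes "shortest_path G x p y" "i \<le> j" "j \<le> length p"
  shows "gdist G (pawalk_verts x p ! i) (pawalk_verts x p ! j) = j - i"
proof -
  let ?a = "pawalk_verts x p ! i" and ?b = "pawalk_verts x p ! j"
  have p: "awalk x p y" "length p = gdist G x y"
    using assms(1) by (auto simp: shortest_path_iff_awalk)
  have start: "awalk x (take i p) ?a" using p(1) assms by (intro awalk_take_drop_nth) auto
  have rest: "awalk ?a (drop i p) y" using p(1) assms by (intro awalk_take_drop_nth) auto
  have tail: "awalk ?b (drop j p) y" using p(1) assms by (intro awalk_take_drop_nth) auto
  have mid: "awalk ?a (take (j - i) (drop i p)) ?b"
  proof -
    have "pawalk_verts ?a (drop i p) ! (j - i) = ?b"
    proof (cases "i < length p")
      case True
      moreover have "pcas x p y" using p(1) by auto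
      ultimately show ?thesis
        using assms length_awalk_verts[of x p] by (simp add: awalk_verts_drop_conv)
    next
      case False
      then have "i = j" "drop i p = []" using assms by simp_all
      then show ?thesis by simp
    qed
    then show ?thesis using awalk_take_drop_nth(1)[OF rest, of "j - i"] assms by simp
  qed
  show ?thesis
  proof (rule le_antisym)
    show "gdist G ?a ?b \<le> j - i" using gdist_le_length[OF mid] by simp
    obtain q where q: "awalk ?a q ?b" "length q = gdist G ?a ?b"
      using mid by (meson gdist_awalkE reachable_awalkI)
    have "gdist G x y \<le> length (take i p @ q @ drop j p)"
      using start q(1) tail by (intro gdist_le_length awalk_appendI)
    then show "j - i \<le> gdist G ?a ?b" using p(2) q(2) assms by simp
  qed
qed

lemma shortest_path_nth_in_ginterval:
  assumes "shortest_path G x p y" "i \<le> j" "j \<le> k" "k \<le> length p"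
  shows "pawalk_verts x p ! j \<in> ginterval G (pawalk_verts x p ! i) (pawalk_verts x p ! k)"
proof -
  have "pawalk_verts x p ! j \<in> set (pawalk_verts x p)" using assms by (simp add: length_awalk_verts)
  then have "pawalk_verts x p ! j \<in> pverts G"
    using assms(1) by (auto simp: shortest_path_iff_awalk)
  then show ?thesis
    unfolding ginterval_def using assms by (simp add: gdist_shortest_path_nth[OF assms(1)])
qed

end

context pair_sym_digraph
begin

lemma gdist_commute: "gdist G x y = gdist G y x"
proof -
  have "length (rev_path p) = length p" for p :: "('a \<times> 'a) awalk" by (induction p) auto
  then have "(\<exists>p. awalk x p y \<and> length p = n) \<longleftrightarrow> (\<exists>p. awalk y p x \<and> length p = n)" for n
    by (metis awalk_rev_path)
  then show ?thesis by (simp add: gdist_def)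
qed

lemma ginterval_commute: "ginterval G x y = ginterval G y x"
  unfolding ginterval_def by (simp add: gdist_commute[of x] gdist_commute[of _ y] add.commute)

lemma shortest_path_three_vertices_ginterval:
  assumes p: "shortest_path G x p y" and abc: "{a, b, c} \<subseteq> set (pawalk_verts x p)"
  shows "a \<in> ginterval G b c \<or> b \<in> ginterval G a c \<or> c \<in> ginterval G a b"
proof -
  let ?v = "\<lambda>i. pawalk_verts x p ! i"
  obtain i j k where len: "i \<le> length p" "j \<le> length p" "k \<le> length p"
    and nth: "a = ?v i" "b = ?v j" "c = ?v k"
    using abc by (auto simp: in_set_conv_nth length_awalk_verts less_Suc_eq_le)
  have between: "?v m \<in> ginterval G (?v l) (?v n)" "?v m \<in> ginterval G (?v n) (?v l)"
    if "l \<le> m" "m \<le> n" "n \<le> length p" for l m n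
    using shortest_path_nth_in_ginterval[OF p that] by (simp_all add: ginterval_commute)
  consider "i \<le> j" "j \<le> k" | "i \<le> k" "k \<le> j" | "j \<le> i" "i \<le> k"
    | "j \<le> k" "k \<le> i" | "k \<le> i" "i \<le> j" | "k \<le> j" "j \<le> i"
    by linarith
  then show ?thesis unfolding nth by cases (use between len in blast)+
qed

end

section \<open>General position sets and antichains in connected graphs\<close>

lemma general_position_subset:
  assumes "general_position H X" "Y \<subseteq> X"
  shows "general_position H Y"
  unfolding general_position_def
proof (intro conjI allI impI)
  show "Y \<subseteq> pverts H" using assms by (auto simp: general_position_def)
  fix x p y
  let ?vs = "set (pre_digraph.awalk_verts (with_proj H) x p)"
  assume "shortest_path H x p y"
  then have "card (X \<inter> ?vs) \<le> 2" using assms(1) unfolding general_position_def by blast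
  moreover have "card (Y \<inter> ?vs) \<le> card (X \<inter> ?vs)" using assms(2) by (intro card_mono) auto
  ultimately show "card (Y \<inter> ?vs) \<le> 2" by simp
qed

context pair_fin_digraph
begin

lemma finite_general_position:
  assumes "general_position G X"
  shows "finite X"
  using assms finite_subset[OF _ pair_finite_verts] by (simp add: general_position_def)

lemma finite_cards_general_position:
  assumes "\<And>S. Q S \<Longrightarrow> general_position G S"
  shows "finite {card S | S. Q S}"
proof -
  have "{card S | S. Q S} \<subseteq> card ` Pow (pverts G)"
    using assms by (auto simp: general_position_def)
  then show ?thesis by (rule finite_subset) (simp add: pair_finite_verts)
qed

lemma card_le_gp:
  assumes "general_position G X"
  shows "card X \<le> gp G"
  unfolding gp_def using assms by (intro Max_ge finite_cards_general_position) auto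

lemma gp_attained:
  obtains X where "general_position G X" "card X = gp G"
proof -
  have "general_position G {}" by (simp add: general_position_def)
  then have "gp G \<in> {card X | X. general_position G X}"
    unfolding gp_def by (intro Max_in finite_cards_general_position) auto
  then show thesis using that by auto
qed

lemma card_le_\<xi>_at:
  assumes "colinear G u S"
  shows "card S \<le> \<xi>_at G u"
  unfolding \<xi>_at_def using assms
  by (intro Max_ge finite_cards_general_position) (auto simp: colinear_def)

lemma \<xi>_at_attained:
  obtains S where "colinear G u S" "card S = \<xi>_at G u"
proof -
  have "colinear G u {}" by (simp add: colinear_def general_position_def)
  then have "\<xi>_at G u \<in> {card S | S. colinear G u S}"
    unfolding \<xi>_at_def by (intro Max_in finite_cards_general_position) (auto simp: colinear_def)
  then show thesis using that by auto
qed

end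

definition interval_antichain :: "'a pair_pre_digraph \<Rightarrow> 'a \<Rightarrow> 'a set \<Rightarrow> bool" where
  "interval_antichain H u S \<longleftrightarrow> (\<forall>x\<in>S. \<forall>y\<in>S. x \<noteq> y \<longrightarrow> y \<notin> ginterval H x u)"

lemma colinear_iff_interval_antichain:
  "colinear H u S \<longleftrightarrow> general_position H S \<and> u \<notin> S \<and> interval_antichain H u S"
  by (simp add: colinear_def interval_antichain_def)

locale connected_pair_graph = pair_graph +
  assumes connected: "Digraph_Component.connected (with_proj G)"
begin

lemma reachable [simp]: "\<lbrakk>x \<in> pverts G; y \<in> pverts G\<rbrakk> \<Longrightarrow> x \<rightarrow>\<^sup>*\<^bsub>G\<^esub> y"
  using symmetric_connected_imp_strongly_connected[OF pair_sym_arcs connected]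
  by (simp add: strongly_connected_def)

lemma pverts_nonempty: "pverts G \<noteq> {}"
  using connected_conv[of "with_proj G"] connected by simp

lemma right_in_ginterval:
  assumes "x \<in> pverts G" "u \<in> pverts G"
  shows "u \<in> ginterval G x u"
  using assms by (simp add: ginterval_def)

lemma ginterval_antisym:
  assumes "x \<in> pverts G" "u \<in> pverts G" "y \<in> ginterval G x u" "x \<in> ginterval G y u"
  shows "x = y"
proof -
  have "y \<in> pverts G" "gdist G x y = 0" using assms by (auto simp: ginterval_def)
  then show ?thesis using assms(1) by (simp add: gdist_eq_0_iff)
qed

lemma ginterval_chain:
  assumes "x \<in> pverts G" "u \<in> pverts G" "y \<in> ginterval G x u" "z \<in> ginterval G y u"
  shows "y \<in> ginterval G x z"
proof -
  have V: "y \<in> pverts G" "z \<in> pverts G" using assms by (auto simp: ginterval_def)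
  have "gdist G x u = gdist G x y + gdist G y z + gdist G z u"
    using assms(3,4) by (simp add: ginterval_def)
  moreover have "gdist G x u \<le> gdist G x z + gdist G z u" "gdist G x z \<le> gdist G x y + gdist G y z"
    using V assms by (simp_all add: gdist_triangle)
  ultimately show ?thesis using V(1) by (simp add: ginterval_def)
qed

lemma ginterval_shortest_pathE:
  assumes "x \<in> pverts G" "z \<in> pverts G" "y \<in> ginterval G x z"
  obtains p where "shortest_path G x p z" "y \<in> set (pawalk_verts x p)"
proof -
  have "y \<in> pverts G" using assms(3) by (simp add: ginterval_def)
  then obtain p q where pq: "awalk x p y" "length p = gdist G x y"
      "awalk y q z" "length q = gdist G y z"
    using assms(1,2) by (metis gdist_awalkE reachable)
  have "shortest_path G x (p @ q) z"
    using pq assms(3) awalk_appendI[OF pq(1,3)] by (simp add: shortest_path_iff_awalk ginterval_def)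
  moreover have "y \<in> set (pawalk_verts x (p @ q))"
    using hd_in_awalk_verts(1)[OF pq(3)] by (simp add: set_awalk_verts_append[OF pq(1,3)])
  ultimately show thesis by (rule that)
qed

lemma general_position_not_in_ginterval:
  assumes gp: "general_position G X" and xyz: "x \<in> X" "y \<in> X" "z \<in> X" "distinct [x, y, z]"
  shows "y \<notin> ginterval G x z"
proof
  assume "y \<in> ginterval G x z"
  moreover have "x \<in> pverts G" "z \<in> pverts G" using gp xyz by (auto simp: general_position_def)
  ultimately obtain p where p: "shortest_path G x p z" "y \<in> set (pawalk_verts x p)"
    using ginterval_shortest_pathE by blast
  have "{x, z} \<subseteq> set (pawalk_verts x p)"
    using p(1) by (auto simp: shortest_path_iff_awalk intro: hd_in_awalk_verts)
  then have "card {x, y, z} \<le> card (X \<inter> set (pawalk_verts x p))"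
    using xyz p(2) by (intro card_mono) auto
  then show False using gp p(1) xyz(4) by (fastforce simp: general_position_def)
qed

lemma general_position_iff_ginterval:
  "general_position G X \<longleftrightarrow>
    X \<subseteq> pverts G \<and> (\<forall>x\<in>X. \<forall>y\<in>X. \<forall>z\<in>X. distinct [x, y, z] \<longrightarrow> y \<notin> ginterval G x z)"
  (is "_ \<longleftrightarrow> _ \<and> ?no_between")
proof
  assume gp: "general_position G X"
  then have "X \<subseteq> pverts G" by (simp add: general_position_def)
  then show "X \<subseteq> pverts G \<and> ?no_between" using general_position_not_in_ginterval[OF gp] by blast
next
  assume X: "X \<subseteq> pverts G \<and> ?no_between"
  show "general_position G X"
    unfolding general_position_def awalk_verts_with_proj_eq
  proof (intro conjI allI impI)
    show "X \<subseteq> pverts G" using X by simp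
    fix x p y
    assume p: "shortest_path G x p y"
    let ?vs = "pawalk_verts x p"
    show "card (X \<inter> set ?vs) \<le> 2"
    proof (rule ccontr)
      assume "\<not> card (X \<inter> set ?vs) \<le> 2"
      then have "3 \<le> card (X \<inter> set ?vs)" by simp
      then obtain T where "T \<subseteq> X \<inter> set ?vs" "card T = 3" by (rule obtain_subset_with_card_n)
      then obtain a b c where abc: "distinct [a, b, c]" "{a, b, c} \<subseteq> X \<inter> set ?vs"
        by (auto simp: card_3_iff)
      then consider "a \<in> ginterval G b c" | "b \<in> ginterval G a c" | "c \<in> ginterval G a b"
        using shortest_path_three_vertices_ginterval[OF p] by blast
      then show False using X abc by cases auto
    qed
  qed
qed

lemma \<xi>_at_pos:
  assumes "card (pverts G) \<ge> 2"
  shows "\<xi>_at G u \<ge> 1"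
proof -
  have "\<not> pverts G \<subseteq> {u}" using assms card_mono[of "{u}" "pverts G"] by auto
  then obtain v where "v \<in> pverts G" "v \<noteq> u" by blast
  then have "colinear G u {v}" by (simp add: colinear_def general_position_iff_ginterval)
  then show ?thesis using card_le_\<xi>_at by fastforce
qed

lemma card_interval_antichain_le:
  assumes "card (pverts G) \<ge> 2" "general_position G S" "interval_antichain G u S"
  shows "card S \<le> \<xi>_at G u"
proof (cases "u \<in> S")
  case True
  have "x = u" if "x \<in> S" for x
  proof -
    have "x \<in> pverts G" "u \<in> pverts G" using assms(2) True that by (auto simp: general_position_def)
    then show ?thesis
      using right_in_ginterval assms(3) True that by (auto simp: interval_antichain_def)
  qed
  then have "card S \<le> 1" using card_mono[of "{u}" S] by auto
  then show ?thesis using \<xi>_at_pos[OF assms(1), of u] by simp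
next
  case False
  then show ?thesis using assms by (intro card_le_\<xi>_at) (simp add: colinear_iff_interval_antichain)
qed

lemma card_general_position_le:
  assumes "card (pverts G) \<ge> 2" "general_position G X" "u \<in> pverts G"
  shows "card X \<le> 2 * \<xi>_at G u"
proof -
  define A where "A = {x \<in> X. \<exists>y\<in>X. y \<noteq> x \<and> y \<in> ginterval G x u}"
  have no_chain: False
    if "x \<in> X" "y \<in> X" "z \<in> X" "x \<noteq> y" "y \<noteq> z" "y \<in> ginterval G x u" "z \<in> ginterval G y u"
    for x y z
  proof -
    have "x \<in> pverts G" using assms(2) that(1) by (auto simp: general_position_def)
    then have "y \<in> ginterval G x z" "x \<noteq> z"
      using that assms(3) ginterval_chain ginterval_antisym by blast+
    then show False using general_position_not_in_ginterval[OF assms(2)] that by simp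
  qed
  have "interval_antichain G u A"
    unfolding interval_antichain_def A_def using no_chain by blast
  moreover have "interval_antichain G u (X - A)"
    unfolding interval_antichain_def A_def by auto
  moreover have "general_position G A" "general_position G (X - A)"
    using assms(2) by (auto intro: general_position_subset simp: A_def)
  ultimately have "card A \<le> \<xi>_at G u" "card (X - A) \<le> \<xi>_at G u"
    using assms(1) by (simp_all add: card_interval_antichain_le)
  moreover have "card X = card A + card (X - A)"
    using card_Int_Diff[OF finite_general_position[OF assms(2)], of A]
    by (simp add: A_def Int_absorb1)
  ultimately show ?thesis by simp
qed

end

section \<open>Sierpinski products\<close>

locale connected_sierpinski_product =
  G: connected_pair_graph G + H: connected_pair_graph H
  for G :: "'a pair_pre_digraph" and H :: "'b pair_pre_digraph" +
  fixes f :: "'a \<Rightarrow> 'b"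
  assumes f_funcset: "f \<in> pverts G \<rightarrow> pverts H"
begin

abbreviation P :: "('a \<times> 'b) pair_pre_digraph" where
  "P \<equiv> sierpinski_product G f H"

lemma f_in_pverts [simp]: "g \<in> pverts G \<Longrightarrow> f g \<in> pverts H"
  using f_funcset by blast

lemma pverts_P [simp]: "pverts P = pverts G \<times> pverts H"
  by (simp add: sierpinski_product_def)

lemma copy_arcI: "\<lbrakk>g \<in> pverts G; (x, y) \<in> parcs H\<rbrakk> \<Longrightarrow> ((g, x), (g, y)) \<in> parcs P"
  by (simp add: sierpinski_product_def)

lemma bridge_arcI: "(g, g') \<in> parcs G \<Longrightarrow> ((g, f g'), (g', f g)) \<in> parcs P"
  by (auto simp: sierpinski_product_def)

lemma arc_P_cases [consumes 1, case_names copy bridge]: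
  assumes "(u, v) \<in> parcs P"
  obtains g x y where "u = (g, x)" "v = (g, y)" "g \<in> pverts G" "(x, y) \<in> parcs H"
  | g g' where "u = (g, f g')" "v = (g', f g)" "(g, g') \<in> parcs G"
  using assms by (auto simp: sierpinski_product_def)

sublocale P: pair_graph P
  by (rule pair_graph_sierpinski_product) (use f_funcset G.pair_graph H.pair_graph in auto)

lemma awalk_copy:
  assumes "H.awalk x p y" "g \<in> pverts G"
  shows "P.awalk (g, x) (map (map_prod (Pair g) (Pair g)) p) (g, y)"
  using assms(1)
proof (induction p arbitrary: x)
  case Nil
  then show ?case using assms(2) by (auto simp: H.awalk_Nil_iff P.awalk_Nil_iff)
next
  case (Cons e p)
  then show ?case
    using assms(2) by (cases e) (auto simp: H.awalk_Cons_iff P.awalk_Cons_iff copy_arcI)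
qed

lemma reachable_copy:
  assumes "g \<in> pverts G" "x \<in> pverts H" "y \<in> pverts H"
  shows "(g, x) \<rightarrow>\<^sup>*\<^bsub>P\<^esub> (g, y)"
  using awalk_copy[OF _ assms(1)] H.reachable[OF assms(2,3)]
  by (meson H.reachable_awalk P.reachable_awalkI)

lemma reachable_P:
  assumes "u \<in> pverts P" "v \<in> pverts P"
  shows "u \<rightarrow>\<^sup>*\<^bsub>P\<^esub> v"
proof -
  have "(g, x) \<rightarrow>\<^sup>*\<^bsub>P\<^esub> (g', y)" if "G.awalk g p g'" "x \<in> pverts H" "y \<in> pverts H" for g p g' x y
    using that
  proof (induction p arbitrary: g x)
    case Nil
    then show ?case by (auto simp: G.awalk_Nil_iff reachable_copy)
  next
    case (Cons e p)
    then have arc: "(g, snd e) \<in> parcs G" and walk: "G.awalk (snd e) p g'"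
      by (auto simp: G.awalk_Cons_iff)
    then have V: "g \<in> pverts G" "snd e \<in> pverts G" by (auto dest: G.wellformed')
    have "(g, x) \<rightarrow>\<^sup>*\<^bsub>P\<^esub> (g, f (snd e))" using V Cons.prems by (simp add: reachable_copy)
    also have "(g, f (snd e)) \<rightarrow>\<^sup>*\<^bsub>P\<^esub> (snd e, f g)"
      using bridge_arcI[OF arc] by (intro P.reachable_adjI) simp
    also have "(snd e, f g) \<rightarrow>\<^sup>*\<^bsub>P\<^esub> (g', y)" using Cons.IH[OF walk] V Cons.prems by simp
    finally show ?case .
  qed
  moreover have "fst u \<rightarrow>\<^sup>*\<^bsub>G\<^esub> fst v" using assms by auto
  ultimately show ?thesis using assms by (cases u; cases v) (auto simp: G.reachable_awalk)
qed

sublocale P: connected_pair_graph P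
proof
  show "Digraph_Component.connected (with_proj P)"
    using G.pverts_nonempty H.pverts_nonempty reachable_P
    by (intro P.connectedI P.reachable_mk_symmetricI) auto
qed

lemma gdist_copy_le:
  assumes "g \<in> pverts G" "x \<in> pverts H" "y \<in> pverts H"
  shows "gdist P (g, x) (g, y) \<le> gdist H x y"
proof -
  obtain p where p: "H.awalk x p y" "length p = gdist H x y"
    using assms by (meson H.gdist_awalkE H.reachable)
  then show ?thesis using P.gdist_le_length[OF awalk_copy[OF p(1) assms(1)]] by simp
qed

lemma gdist_bridge_le:
  assumes "(g, g') \<in> parcs G" "x \<in> pverts H" "y \<in> pverts H"
  shows "gdist P (g, x) (g', y) \<le> gdist H x (f g') + 1 + gdist H (f g) y"
proof -
  have V: "g \<in> pverts G" "g' \<in> pverts G" using assms(1) by (auto dest: G.wellformed')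
  have "gdist P (g, x) (g', y) \<le> gdist P (g, x) (g, f g') + gdist P (g, f g') (g', y)"
    using V assms by (intro P.gdist_triangle) simp_all
  also have "gdist P (g, f g') (g', y) \<le> Suc (gdist P (g', f g) (g', y))"
    using V assms by (intro P.gdist_arc_le_Suc bridge_arcI) simp_all
  also have "gdist P (g, x) (g, f g') \<le> gdist H x (f g')" using V assms by (simp add: gdist_copy_le)
  also have "gdist P (g', f g) (g', y) \<le> gdist H (f g) y" using V assms by (simp add: gdist_copy_le)
  finally show ?thesis by simp
qed

end

section \<open>Products with the complete graph on two vertices\<close>

lemma complete_digraph_connected_pair_graph:
  assumes "complete_digraph n (with_proj G)" "n > 0"
  shows "connected_pair_graph G"
proof -
  interpret pair_graph G using assms(1) by (rule pair_graphI_complete)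
  have "x \<rightarrow>\<^sup>*\<^bsub>G\<^esub> y" if "x \<in> pverts G" "y \<in> pverts G" for x y
    using that assms(1)
    by (cases "x = y") (auto simp: complete_digraph_pair_def intro: reachable_adjI)
  then show ?thesis
    using assms by unfold_locales
      (auto simp: complete_digraph_pair_def intro!: connectedI reachable_mk_symmetricI)
qed

locale sierpinski_product_K2 = H: connected_pair_graph H
  for K :: "'a pair_pre_digraph" and H :: "'b pair_pre_digraph" and f :: "'a \<Rightarrow> 'b" +
  assumes complete_K: "complete_digraph 2 (with_proj K)"
    and f_maps: "f \<in> pverts K \<rightarrow> pverts H"

sublocale sierpinski_product_K2 \<subseteq> connected_sierpinski_product K H f
  by (intro connected_sierpinski_product.intro connected_sierpinski_product_axioms.intro
      complete_digraph_connected_pair_graph[OF complete_K] H.connected_pair_graph_axioms f_maps)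
    simp

context sierpinski_product_K2
begin

lemma arc_K_iff: "(g, g') \<in> parcs K \<longleftrightarrow> g \<in> pverts K \<and> g' \<in> pverts K \<and> g \<noteq> g'"
  using complete_K by (auto simp: complete_digraph_pair_def)

lemma pverts_KE:
  obtains g g' where "pverts K = {g, g'}" "g \<noteq> g'"
  using complete_K by (auto simp: complete_digraph_pair_def card_2_iff)

lemma pverts_K_eq:
  assumes "g \<in> pverts K" "g' \<in> pverts K" "g \<noteq> g'"
  shows "pverts K = {g, g'}"
  using assms by (auto intro: pverts_KE)

lemma gdist_P_lower_bound:
  assumes "g \<in> pverts K" "g' \<in> pverts K" "x \<in> pverts H" "y \<in> pverts H"
  shows "(if g = g' then gdist H x y else gdist H x (f g') + 1 + gdist H (f g) y)
    \<le> gdist P (g, x) (g', y)"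
proof -
  \<comment> \<open>the claimed distance to \<open>(g', y)\<close>: a potential that drops by at most 1 along every arc\<close>
  define \<phi> where "\<phi> = (\<lambda>(c, h). if c = g' then gdist H h y
    else gdist H h (f g') + 1 + gdist H (f c) y)"
  have "\<phi> (g, x) \<le> \<phi> (g', y) + gdist P (g, x) (g', y)"
  proof (rule P.potential_le_add_gdist)
    show "(g, x) \<rightarrow>\<^sup>*\<^bsub>P\<^esub> (g', y)" using assms by simp
    show "\<phi> u \<le> Suc (\<phi> v)" if "(u, v) \<in> parcs P" for u v
      using that
    proof (cases rule: arc_P_cases)
      case (copy c h h')
      then have "h' \<in> pverts H" by (auto dest: H.wellformed')
      then have "gdist H h z \<le> Suc (gdist H h' z)" if "z \<in> pverts H" for z
        using copy that by (intro H.gdist_arc_le_Suc) simp_all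
      then show ?thesis using copy assms by (simp add: \<phi>_def)
    next
      case (bridge c c')
      then have "c \<in> pverts K" "c' \<in> pverts K" "c \<noteq> c'" by (simp_all add: arc_K_iff)
      then have "c = g' \<or> c' = g'" using pverts_K_eq assms(2) by blast
      then show ?thesis using bridge \<open>c \<noteq> c'\<close> assms by (auto simp: \<phi>_def)
    qed
  qed
  then show ?thesis using assms by (simp add: \<phi>_def)
qed

lemma gdist_copy:
  assumes "g \<in> pverts K" "x \<in> pverts H" "y \<in> pverts H"
  shows "gdist P (g, x) (g, y) = gdist H x y"
  using gdist_copy_le[OF assms] gdist_P_lower_bound[OF assms(1,1,2,3)] by simp

lemma gdist_bridge:
  assumes "g \<in> pverts K" "g' \<in> pverts K" "g \<noteq> g'" "x \<in> pverts H" "y \<in> pverts H"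
  shows "gdist P (g, x) (g', y) = gdist H x (f g') + 1 + gdist H (f g) y"
  using gdist_bridge_le[of g g' x y] gdist_P_lower_bound[OF assms(1,2,4,5)] assms
  by (simp add: arc_K_iff)

lemma ginterval_copy:
  assumes "g \<in> pverts K" "x \<in> pverts H" "z \<in> pverts H"
  shows "ginterval P (g, x) (g, z) = {g} \<times> ginterval H x z"
proof -
  have "(c, y) \<in> ginterval P (g, x) (g, z) \<longleftrightarrow> c = g \<and> y \<in> ginterval H x z"
    if "c \<in> pverts K" "y \<in> pverts H" for c y
  proof (cases "c = g")
    case True
    then show ?thesis using assms that by (simp add: ginterval_def gdist_copy)
  next
    case False
    have "gdist H x z \<le> gdist H x (f c) + gdist H (f c) z"
      using assms that by (intro H.gdist_triangle) simp_all
    then show ?thesis using False assms that by (simp add: ginterval_def gdist_copy gdist_bridge)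
  qed
  then show ?thesis using assms(1) by (auto simp: ginterval_def)
qed

lemma ginterval_bridge:
  assumes "g \<in> pverts K" "g' \<in> pverts K" "g \<noteq> g'" "x \<in> pverts H" "z \<in> pverts H"
  shows "ginterval P (g, x) (g', z) =
    {g} \<times> ginterval H x (f g') \<union> {g'} \<times> ginterval H (f g) z"
  using pverts_K_eq[OF assms(1-3)] assms(3-5)
  by (auto simp: ginterval_def gdist_copy gdist_bridge)

lemma ginterval_P_cases [consumes 5, case_names copy left right]:
  assumes "(c, y) \<in> ginterval P (g, x) (g', z)"
    and "g \<in> pverts K" "g' \<in> pverts K" "x \<in> pverts H" "z \<in> pverts H"
  obtains "g' = g" "c = g" "y \<in> ginterval H x z"
  | "g' \<noteq> g" "c = g" "y \<in> ginterval H x (f g')"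
  | "g' \<noteq> g" "c = g'" "y \<in> ginterval H z (f g)"
  using assms H.ginterval_commute[of "f g" z]
  by (cases "g' = g") (auto simp: ginterval_copy ginterval_bridge)

lemma general_position_slice:
  assumes gp: "general_position P X" and g: "g \<in> pverts K"
  shows "general_position H (X `` {g})"
proof -
  have sub: "X `` {g} \<subseteq> pverts H" using gp by (auto simp: general_position_def)
  have "y \<notin> ginterval H x z"
    if "x \<in> X `` {g}" "y \<in> X `` {g}" "z \<in> X `` {g}" "distinct [x, y, z]" for x y z
  proof -
    have "(g, y) \<notin> ginterval P (g, x) (g, z)"
      using P.general_position_not_in_ginterval[OF gp] that by simp
    moreover have "x \<in> pverts H" "z \<in> pverts H" using that sub by blast+
    ultimately show ?thesis using g by (simp add: ginterval_copy)
  qed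
  then show ?thesis unfolding H.general_position_iff_ginterval using sub by blast
qed

lemma interval_antichain_slice:
  assumes gp: "general_position P X"
    and g: "g \<in> pverts K" "g' \<in> pverts K" "g \<noteq> g'" and "X `` {g'} \<noteq> {}"
  shows "interval_antichain H (f g') (X `` {g})"
  unfolding interval_antichain_def
proof (intro ballI impI)
  fix x y assume xy: "x \<in> X `` {g}" "y \<in> X `` {g}" "x \<noteq> y"
  obtain z where z: "(g', z) \<in> X" using assms(5) by blast
  have "(g, y) \<notin> ginterval P (g, x) (g', z)"
    using P.general_position_not_in_ginterval[OF gp] xy z g(3) by simp
  moreover have "x \<in> pverts H" "z \<in> pverts H"
    using gp xy z by (auto simp: general_position_def)
  ultimately show "y \<notin> ginterval H x (f g')" using g by (simp add: ginterval_bridge)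
qed

lemma general_position_Sigma:
  assumes col: "\<And>g g'. \<lbrakk>g \<in> pverts K; g' \<in> pverts K; g \<noteq> g'\<rbrakk> \<Longrightarrow> colinear H (f g') (S g)"
  shows "general_position P (Sigma (pverts K) S)"
proof -
  have gp: "general_position H (S g)" if "g \<in> pverts K" for g
  proof -
    obtain g' where "g' \<in> pverts K" "g \<noteq> g'" by (rule pverts_KE) (use that in auto)
    then show ?thesis using col that by (simp add: colinear_def)
  qed
  then have sub: "x \<in> pverts H" if "g \<in> pverts K" "x \<in> S g" for g x
    using that by (auto simp: general_position_def)
  have False
    if K: "g \<in> pverts K" "c \<in> pverts K" "g' \<in> pverts K" and S: "x \<in> S g" "y \<in> S c" "z \<in> S g'"
      and dist: "distinct [(g, x), (c, y), (g', z)]"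
      and between: "(c, y) \<in> ginterval P (g, x) (g', z)" for g x c y g' z
  proof -
    have "x \<in> pverts H" "z \<in> pverts H" using sub K S by blast+
    from between K(1,3) this show False
    proof (cases rule: ginterval_P_cases)
      case copy
      then show False using H.general_position_not_in_ginterval[OF gp[OF K(1)]] S dist by simp
    next
      case left
      then show False using col[of g g'] K S dist by (auto simp: colinear_def)
    next
      case right
      then show False using col[of g' g] K S dist by (auto simp: colinear_def)
    qed
  qed
  then show ?thesis
    unfolding P.general_position_iff_ginterval using sub by (auto simp del: distinct.simps)
qed

lemma card_general_position_eq_sum_slices:
  assumes "general_position P X"
  shows "card X = (\<Sum>g\<in>pverts K. card (X `` {g}))"
proof -
  have "X = Sigma (pverts K) (\<lambda>g. X `` {g})" using assms by (auto simp: general_position_def)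
  moreover have "\<forall>g\<in>pverts K. finite (X `` {g})"
    using assms by (auto intro: general_position_slice H.finite_general_position)
  ultimately show ?thesis using card_SigmaI[OF G.pair_finite_verts] by metis
qed

lemma card_general_position_P_le:
  assumes card_H: "card (pverts H) \<ge> 2" and X: "general_position P X"
  shows "card X \<le> (\<Sum>g\<in>pverts K. \<xi>_at H (f g))"
proof -
  obtain g g' where K: "pverts K = {g, g'}" "g \<noteq> g'" by (rule pverts_KE)
  have slices: "general_position H (X `` {g})" "general_position H (X `` {g'})"
    using X K by (simp_all add: general_position_slice)
  have card: "card X = card (X `` {g}) + card (X `` {g'})"
    using card_general_position_eq_sum_slices[OF X] K by simp
  have f: "f g \<in> pverts H" "f g' \<in> pverts H" using K by simp_all
  have one_copy: "card S \<le> \<xi>_at H (f g) + \<xi>_at H (f g')" if "general_position H S" for S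
    using H.card_general_position_le[OF card_H that f(1)] H.card_general_position_le[OF card_H that f(2)]
    by simp
  consider (second) "X `` {g} = {}" | (first) "X `` {g'} = {}" | (both) "X `` {g} \<noteq> {}" "X `` {g'} \<noteq> {}" by blast
  then have "card X \<le> \<xi>_at H (f g) + \<xi>_at H (f g')"
  proof cases
    case second
    then show ?thesis using card one_copy[OF slices(2)] by simp
  next
    case first
    then show ?thesis using card one_copy[OF slices(1)] by simp
  next
    case both
    then have "interval_antichain H (f g') (X `` {g})" "interval_antichain H (f g) (X `` {g'})"
      using X K by (simp_all add: interval_antichain_slice)
    then have "card (X `` {g}) \<le> \<xi>_at H (f g')" "card (X `` {g'}) \<le> \<xi>_at H (f g)"
      using card_H slices by (simp_all add: H.card_interval_antichain_le)
    then show ?thesis using card by simp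
  qed
  then show ?thesis using K by simp
qed

lemma gp_sierpinski_product_K2:
  assumes "card (pverts H) \<ge> 2"
  shows "gp P = (\<Sum>g\<in>pverts K. \<xi>_at H (f g))"
proof (rule le_antisym)
  obtain X where "general_position P X" "card X = gp P" by (rule P.gp_attained)
  then show "gp P \<le> (\<Sum>g\<in>pverts K. \<xi>_at H (f g))"
    using card_general_position_P_le[OF assms] by metis
next
  obtain g g' where K: "pverts K = {g, g'}" "g \<noteq> g'" by (rule pverts_KE)
  obtain A where A: "colinear H (f g') A" "card A = \<xi>_at H (f g')" by (rule H.\<xi>_at_attained)
  obtain B where B: "colinear H (f g) B" "card B = \<xi>_at H (f g)" by (rule H.\<xi>_at_attained)
  define S where "S = (\<lambda>c. if c = g then A else B)"
  have gp: "general_position P (Sigma (pverts K) S)"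
    using A B K by (intro general_position_Sigma) (auto simp: S_def)
  have "(\<Sum>g\<in>pverts K. \<xi>_at H (f g)) = card B + card A" using A B K by simp
  also have "\<dots> = card (Sigma (pverts K) S)"
    using A B K by (simp add: S_def colinear_def H.finite_general_position)
  also have "\<dots> \<le> gp P" by (rule P.card_le_gp[OF gp])
  finally show "(\<Sum>g\<in>pverts K. \<xi>_at H (f g)) \<le> gp P" .
qed

end

section \<open>Extreme values over all functions\<close>

lemma
  fixes h :: "'b \<Rightarrow> 'c :: linordered_semidom"
  assumes "finite A" "finite V" "V \<noteq> {}"
  shows Min_sum_PiE: "Min {\<Sum>a\<in>A. h (f a) | f. f \<in> A \<rightarrow>\<^sub>E V} = of_nat (card A) * Min (h ` V)"
    and Max_sum_PiE: "Max {\<Sum>a\<in>A. h (f a) | f. f \<in> A \<rightarrow>\<^sub>E V} = of_nat (card A) * Max (h ` V)"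
proof -
  let ?D = "{\<Sum>a\<in>A. h (f a) | f. f \<in> A \<rightarrow>\<^sub>E V}"
  have fin: "finite ?D" using assms by (simp add: Setcompr_eq_image finite_PiE)
  have const: "of_nat (card A) * m \<in> ?D" if m: "m \<in> h ` V" for m
  proof -
    obtain v where "v \<in> V" "m = h v" using m by blast
    then show ?thesis by (intro CollectI exI[of _ "\<lambda>a\<in>A. v"]) auto
  qed
  show "Min ?D = of_nat (card A) * Min (h ` V)"
  proof (rule Min_eqI[OF fin])
    show "of_nat (card A) * Min (h ` V) \<in> ?D" using assms by (intro const Min_in) auto
    show "of_nat (card A) * Min (h ` V) \<le> d" if "d \<in> ?D" for d
      using that assms by (auto dest: PiE_mem intro!: sum_bounded_below Min_le)
  qed
  show "Max ?D = of_nat (card A) * Max (h ` V)"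
  proof (rule Max_eqI[OF fin])
    show "of_nat (card A) * Max (h ` V) \<in> ?D" using assms by (intro const Max_in) auto
    show "d \<le> of_nat (card A) * Max (h ` V)" if "d \<in> ?D" for d
      using that assms by (auto dest: PiE_mem intro!: sum_bounded_above Max_ge)
  qed
qed

theorem theorem4p4:
  fixes K2 :: "'a pair_pre_digraph" and H :: "'b pair_pre_digraph"
  assumes K2: "complete_digraph 2 (with_proj K2)"
    and H: "pair_graph H"
    and H_connected: "Digraph_Component.connected (with_proj H)"
    and H_card: "card (pverts H) \<ge> 2"
  shows "gp_S_min K2 H = 2 * \<xi>_min H \<and> gp_S_max K2 H = 2 * \<xi>_max H"
proof -
  interpret H: connected_pair_graph H
    using H H_connected by (intro connected_pair_graph.intro connected_pair_graph_axioms.intro)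
  have gp: "gp (sierpinski_product K2 f H) = (\<Sum>g\<in>pverts K2. \<xi>_at H (f g))"
    if "f \<in> pverts K2 \<rightarrow>\<^sub>E pverts H" for f
  proof -
    interpret sierpinski_product_K2 K2 H f using K2 that by unfold_locales auto
    show ?thesis by (rule gp_sierpinski_product_K2[OF H_card])
  qed
  have gp_values: "{gp (sierpinski_product K2 f H) | f. f \<in> pverts K2 \<rightarrow>\<^sub>E pverts H} =
      {\<Sum>g\<in>pverts K2. \<xi>_at H (f g) | f. f \<in> pverts K2 \<rightarrow>\<^sub>E pverts H}"
    by (intro Collect_cong) (metis gp)
  have "finite (pverts K2)" "card (pverts K2) = 2"
    using K2 by (simp_all add: complete_digraph_pair_def)
  then show ?thesis
    using H.pair_finite_verts H.pverts_nonempty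
    by (simp add: gp_S_min_def gp_S_max_def \<xi>_min_def \<xi>_max_def gp_values Min_sum_PiE Max_sum_PiE)
qed

end
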